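(* Let $\Gamma$ be a simple graph on $V=\{1,\dots,n\}$ with edge ideal $I\subseteq k[x_1,\dots,x_n]$, let $t\ge 1$ be an integer, and let $P_F$ ($F\subseteq V$ a cover of $\Gamma$) be an arbitrary embedded associated prime of $I^t$. Then $F$ is minimal among the covers of $\Gamma$ containing $N[U]$ for a subset $U$ of $V$ such that every connected component of the induced graph $\Gamma_U$ contains at least one odd cycle of length $\le 2t-1$.
   Context: $k$ is a field, $n\ge 1$. The edge ideal of $\Gamma$ is the ideal generated by the $x_ix_j$ with $\{i,j\}$ an edge of $\Gamma$. A cover of $\Gamma$ is a set of vertices meeting every edge. For $F\subseteq V$, $P_F$ is the ideal generated by the variables $x_i$, $i\in F$; every associated prime of $I^t$ is of the form $P_F$ with $F$ a cover. Embedded associated prime means non-minimal associated prime. For $U\subseteq V$, $\Gamma_U$ is the induced subgraph of $\Gamma$ on $U$, and $N[U]$ is the union of $U$ and the set of vertices adjacent to some vertex of $U$ (closed neighborhood). "$F$ is minimal among the covers containing $N$" means that $F$ is a cover containing $N$ and no proper subset of $F$ is a cover containing $N$. *)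

theory Defs
  imports "HOL-Algebra.Ideal_Product" "HOL-Library.Poly_Mapping"
begin

section \<open>Polynomial rings\<close>

text \<open>
  Monomials are finitely supported exponent functions; a polynomial maps monomials to coefficients
  with finite support. The library's multiplication on \<open>poly_mapping\<close> is the convolution product.
  The type allows a variable for every natural number, so the ring in the variables indexed by \<open>V\<close>
  is given by an explicit carrier.
\<close>

type_synonym 'k mpoly = "(nat \<Rightarrow>\<^sub>0 nat) \<Rightarrow>\<^sub>0 'k"

definition poly_ring :: "nat set \<Rightarrow> 'k::field mpoly ring" where
  "poly_ring V = \<lparr>carrier = {p. \<forall>m\<in>Poly_Mapping.keys p. Poly_Mapping.keys m \<subseteq> V},
                  mult = (*), one = 1, zero = 0, add = (+)\<rparr>"

definition pvar :: "nat \<Rightarrow> 'k::field mpoly" where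
  "pvar i = Poly_Mapping.single (Poly_Mapping.single i 1) 1"

lemma poly_ring_cring: "cring (poly_ring V :: 'k::field mpoly ring)"
proof -
  have add: "p + q \<in> carrier (poly_ring V)"
    if "p \<in> carrier (poly_ring V)" "q \<in> carrier (poly_ring V)" for p q :: "'k mpoly"
    using that Poly_Mapping.keys_add[of p q] by (auto simp: poly_ring_def)
  have mult: "p * q \<in> carrier (poly_ring V)"
    if "p \<in> carrier (poly_ring V)" "q \<in> carrier (poly_ring V)" for p q :: "'k mpoly"
  proof -
    have "Poly_Mapping.keys m \<subseteq> V" if m: "m \<in> Poly_Mapping.keys (p * q)" for m
    proof -
      obtain a b where ab: "m = a + b" "a \<in> Poly_Mapping.keys p" "b \<in> Poly_Mapping.keys q"
        using m Poly_Mapping.keys_mult[of p q] by blast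
      then show ?thesis
        using \<open>p \<in> _\<close> \<open>q \<in> _\<close> Poly_Mapping.keys_add[of a b] by (fastforce simp: poly_ring_def)
    qed
    then show ?thesis by (simp add: poly_ring_def)
  qed
  have neg: "- p \<in> carrier (poly_ring V)"
    if "p \<in> carrier (poly_ring V)" for p :: "'k mpoly"
    using that by (simp add: poly_ring_def)
  have sel: "mult (poly_ring V) = (*)" "one (poly_ring V) = (1 :: 'k mpoly)"
    "zero (poly_ring V) = (0 :: 'k mpoly)" "add (poly_ring V) = (+)"
    by (simp_all add: poly_ring_def)
  show ?thesis
  proof (rule cringI)
    show "abelian_group (poly_ring V :: 'k mpoly ring)"
    proof (rule abelian_groupI)
      fix p :: "'k mpoly" assume "p \<in> carrier (poly_ring V)"
      then show "\<exists>q\<in>carrier (poly_ring V). q \<oplus>\<^bsub>poly_ring V\<^esub> p = \<zero>\<^bsub>poly_ring V\<^esub>"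
        using neg by (intro bexI[of _ "- p"]) (auto simp: sel)
    qed (auto simp: sel add algebra_simps, simp add: poly_ring_def)
    show "comm_monoid (poly_ring V :: 'k mpoly ring)"
      by (rule comm_monoidI) (auto simp: sel mult algebra_simps, simp add: poly_ring_def)
  qed (simp add: sel algebra_simps)
qed

section \<open>Associated primes\<close>

text \<open>The associated primes of \<open>J\<close> are those of the module \<open>R/J\<close>: the primes of the form \<open>J : f\<close>.\<close>

definition associated_prime :: "('a, 'b) ring_scheme \<Rightarrow> 'a set \<Rightarrow> 'a set \<Rightarrow> bool" where
  "associated_prime R J P \<longleftrightarrow>
     primeideal P R \<and> (\<exists>f\<in>carrier R. P = {g \<in> carrier R. g \<otimes>\<^bsub>R\<^esub> f \<in> J})"

definition embedded_associated_prime :: "('a, 'b) ring_scheme \<Rightarrow> 'a set \<Rightarrow> 'a set \<Rightarrow> bool" where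
  "embedded_associated_prime R J P \<longleftrightarrow>
     associated_prime R J P \<and> (\<exists>Q. associated_prime R J Q \<and> Q \<subset> P)"

section \<open>Graphs\<close>

text \<open>
  A graph is given by its vertex set \<open>V\<close> and its set \<open>E\<close> of edges, each edge being the set of
  its two ends. Cycles are cyclic sequences of at least three distinct vertices; in the
  symmetric digraphs of the AFP entry \<open>Graph_Theory\<close>, a closed walk \<open>a, b, a\<close> is also a cycle.
\<close>

definition simple_graph :: "'v set \<Rightarrow> 'v set set \<Rightarrow> bool" where
  "simple_graph V E \<longleftrightarrow> finite V \<and> (\<forall>e\<in>E. e \<subseteq> V \<and> card e = 2)"

definition graph_cover :: "'v set \<Rightarrow> 'v set set \<Rightarrow> 'v set \<Rightarrow> bool" where
  "graph_cover V E F \<longleftrightarrow> F \<subseteq> V \<and> (\<forall>e\<in>E. F \<inter> e \<noteq> {})"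

definition minimal_cover_containing :: "'v set \<Rightarrow> 'v set set \<Rightarrow> 'v set \<Rightarrow> 'v set \<Rightarrow> bool" where
  "minimal_cover_containing V E N F \<longleftrightarrow>
     graph_cover V E F \<and> N \<subseteq> F \<and> (\<forall>F'. F' \<subset> F \<longrightarrow> \<not> (graph_cover V E F' \<and> N \<subseteq> F'))"

definition closed_nbhd :: "'v set set \<Rightarrow> 'v set \<Rightarrow> 'v set" where
  "closed_nbhd E U = U \<union> {v. \<exists>u\<in>U. {u, v} \<in> E}"

definition induced_edges :: "'v set set \<Rightarrow> 'v set \<Rightarrow> 'v set set" where
  "induced_edges E U = {e \<in> E. e \<subseteq> U}"

text \<open>Connected components are represented by their vertex sets.\<close>

definition connected_comps :: "'v set \<Rightarrow> 'v set set \<Rightarrow> 'v set set" where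
  "connected_comps V E = V // {(u, v) \<in> V \<times> V. (u, v) \<in> {(a, b). {a, b} \<in> E}\<^sup>*}"

definition graph_cycle :: "'v set set \<Rightarrow> 'v list \<Rightarrow> bool" where
  "graph_cycle E c \<longleftrightarrow> length c \<ge> 3 \<and> distinct c \<and>
     (\<forall>i<length c. {c ! i, c ! (Suc i mod length c)} \<in> E)"

section \<open>Edge ideals\<close>

definition edge_ideal :: "nat set \<Rightarrow> nat set set \<Rightarrow> 'k::field mpoly set" where
  "edge_ideal V E = Idl\<^bsub>poly_ring V\<^esub> {pvar i * pvar j | i j. {i, j} \<in> E}"

definition var_ideal :: "nat set \<Rightarrow> nat set \<Rightarrow> 'k::field mpoly set" where
  "var_ideal V F = Idl\<^bsub>poly_ring V\<^esub> (pvar ` F)"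

text \<open>Powers of ideals are powers in the library's monoid of ideals under the ideal product.\<close>

abbreviation ideal_power :: "'a ring \<Rightarrow> 'a set \<Rightarrow> nat \<Rightarrow> 'a set" where
  "ideal_power R I t \<equiv> I [^]\<^bsub>ideals_set R\<^esub> t"

end

theory Submission
  imports Defs
begin

text \<open>
  Write \<open>P\<^sub>F = I\<^sup>t : x\<^sup>a\<close> with a monomial \<open>x\<^sup>a\<close>. Then \<open>x\<^sup>a\<close> is not divisible by a product of \<open>t\<close>
  edges, even after multiplication by variables outside \<open>F\<close>, while each \<open>x\<^sup>a x\<^sub>i\<close> with \<open>i \<in> F\<close> is.
  Let \<open>U\<close> consist of those \<open>j \<in> F\<close> for which \<open>x\<^sup>a / x\<^sub>j\<close> is still divisible by a product of
  \<open>t - 1\<close> edges. A neighbour of \<open>U\<close> outside \<open>F\<close> would raise the packing number of \<open>x\<^sup>a\<close>, so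
  \<open>N[U] \<subseteq> F\<close>; removing one edge at \<open>i\<close> from a packing of \<open>x\<^sup>a x\<^sub>i\<close> shows that each \<open>i \<in> F\<close> is
  adjacent to \<open>U\<close> or to a vertex outside \<open>F\<close>, which gives minimality. For \<open>j \<in> U\<close>, comparing a
  packing of \<open>x\<^sup>a / x\<^sub>j\<close> by \<open>t - 1\<close> edges with one of \<open>x\<^sup>a x\<^sub>j\<close> by \<open>t\<close> edges yields an alternating
  closed walk through \<open>j\<close> inside \<open>U\<close>, of odd length at most \<open>2t - 1\<close>.
\<close>

section \<open>Packing edges into a monomial\<close>

abbreviation unit_exp :: "'v \<Rightarrow> 'v \<Rightarrow>\<^sub>0 nat" where
  "unit_exp v \<equiv> Poly_Mapping.single v 1"

inductive packs :: "'v set set \<Rightarrow> nat \<Rightarrow> ('v \<Rightarrow>\<^sub>0 nat) \<Rightarrow> bool" for E where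
  packs_0: "packs E 0 w"
| packs_Suc: "packs E s w \<Longrightarrow> {u, v} \<in> E \<Longrightarrow> packs E (Suc s) (w + unit_exp u + unit_exp v)"

inductive_cases packs_SucE: "packs E (Suc s) w"

lemma packs_mono: "packs E s w \<Longrightarrow> packs E s (w + w')"
proof (induction rule: packs.induct)
  case (packs_Suc s w u v)
  then show ?case
    using packs.packs_Suc[of E s "w + w'" u v] by (simp add: ac_simps)
qed (rule packs.packs_0)

lemma packs_add: "packs E r v \<Longrightarrow> packs E s w \<Longrightarrow> packs E (r + s) (v + w)"
proof (induction rule: packs.induct)
  case (packs_0 v)
  then show ?case
    using packs_mono[of E s w v] by (simp add: add.commute)
next
  case (packs_Suc r w' u v)
  then show ?case
    using packs.packs_Suc[of E "r + s" "w' + w" u v] by (simp add: ac_simps)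
qed

text \<open>Cancellation in a free commutative monoid: if \<open>x\<close> and \<open>y\<close>
  differ, then \<open>y\<close> must already occur in \<open>w\<close>.\<close>

lemma add_unit_exp_eq_cases:
  assumes "w + unit_exp x = w' + unit_exp y"
  obtains "x = y" "w = w'" | w'' where "w = w'' + unit_exp y" "w' = w'' + unit_exp x"
proof (cases "x = y")
  case True
  then show thesis using assms that(1) by simp
next
  case False
  define w'' where "w'' = w - unit_exp y"
  have eq: "Poly_Mapping.lookup w v + (1 when x = v) = Poly_Mapping.lookup w' v + (1 when y = v)" for v
    using arg_cong[OF assms, of "\<lambda>p. Poly_Mapping.lookup p v"] by (simp add: lookup_add lookup_single)
  have "Poly_Mapping.lookup w v = Poly_Mapping.lookup (w'' + unit_exp y) v"
    "Poly_Mapping.lookup w' v = Poly_Mapping.lookup (w'' + unit_exp x) v" for v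
    using eq[of v] False
    by (cases "x = v"; cases "y = v"; simp add: w''_def lookup_add lookup_minus lookup_single)+
  then have "w = w'' + unit_exp y" "w' = w'' + unit_exp x"
    by (auto intro: poly_mapping_eqI)
  then show thesis using that(2) by blast
qed

text \<open>As \<open>w\<close> alone does not hold \<open>s\<close> edges, every packing of
  \<open>w + unit_exp z\<close> uses the added \<open>z\<close>; \<open>p\<close> is its partner
  there, and deleting their edge leaves the remaining edges inside \<open>w\<close> without
  \<open>p\<close>.\<close>

lemma packs_neighbour:
  assumes "packs E s (w + unit_exp z)" "\<not> packs E s w"
  obtains s' p w' where "s = Suc s'" "{z, p} \<in> E" "w = w' + unit_exp p" "packs E s' w'"
proof -
  have "\<exists>s' p w'. s = Suc s' \<and> {z, p} \<in> E \<and> w = w' + unit_exp p \<and> packs E s' w'"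
    if "packs E s x" "x = w + unit_exp z" "\<not> packs E s w" for x
    using that
  proof (induction arbitrary: w rule: packs.induct)
    case packs_0
    then show ?case using packs.packs_0 by blast
  next
    case (packs_Suc s w0 u v)
    from packs_Suc.prems(1) show ?case
    proof (cases rule: add_unit_exp_eq_cases)
      case 1
      then have "{z, u} \<in> E" "w = w0 + unit_exp u"
        using packs_Suc.hyps(2) by (auto simp: insert_commute)
      then show ?thesis
        using packs_Suc.hyps(1) by blast
    next
      case w1: (2 w1)
      from w1(1) show ?thesis
      proof (cases rule: add_unit_exp_eq_cases)
        case 1
        then have "{z, v} \<in> E" "w = w0 + unit_exp v"
          using packs_Suc.hyps(2) w1(2) by auto
        then show ?thesis
          using packs_Suc.hyps(1) by blast
      next
        case w2: (2 w2)
        then have w: "w = w2 + unit_exp u + unit_exp v"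
          using w1 by simp
        \<comment> \<open>Here the last edge \<open>{u, v}\<close> avoids the added \<open>z\<close>
          and lies within \<open>w\<close>, so it is set aside for the induction hypothesis and put
          back afterwards.\<close>
        have "\<not> packs E s w2"
          using packs.packs_Suc[OF _ packs_Suc.hyps(2), of s w2] packs_Suc.prems(2) w by blast
        then obtain s' p w' where
          *: "s = Suc s'" "{z, p} \<in> E" "w2 = w' + unit_exp p" "packs E s' w'"
          using packs_Suc.IH[of w2] w2(1) by blast
        have "w = (w' + unit_exp u + unit_exp v) + unit_exp p"
          using w *(3) by (simp add: ac_simps)
        then show ?thesis
          using *(1,2) packs.packs_Suc[OF *(4) packs_Suc.hyps(2)] by blast
      qed
    qed
  qed
  then show thesis using assms that by blast
qed

text \<open>
  The edges of the walk alternate between a packing of \<open>b + z + j\<close> and a packing of \<open>b\<close>;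
  exchanging the two along an initial or final segment of the walk frees each of its vertices.
\<close>

lemma alternating_walk:
  assumes "packs E s b" "packs E (Suc s) (b + unit_exp z + unit_exp j)"
    and "\<not> packs E (Suc s) (b + unit_exp z)" "\<not> packs E (Suc s) (b + unit_exp j)"
  shows "\<exists>xs. xs \<noteq> [] \<and> hd xs = z \<and> successively (\<lambda>x y. {x, y} \<in> E) (xs @ [j]) \<and>
           odd (length xs) \<and> length xs \<le> 2 * s + 1 \<and>
           (\<forall>x\<in>set xs. \<exists>w. packs E s w \<and>
              (w + unit_exp x = b + unit_exp z \<or> w + unit_exp x = b + unit_exp j))"
  using assms
proof (induction s arbitrary: b z rule: less_induct)
  case (less s)
  let ?free = "\<lambda>s b z x. \<exists>w. packs E s w \<and>
    (w + unit_exp x = b + unit_exp z \<or> w + unit_exp x = b + unit_exp j)"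
  have free_z: "?free s b z z"
    using less.prems(1) by blast
  have "packs E (Suc s) ((b + unit_exp j) + unit_exp z)"
    using less.prems(2) by (simp add: ac_simps)
  \<comment> \<open>\<open>p\<close> is the partner of \<open>z\<close> in the larger packing; if
    \<open>p = j\<close>, the walk ends with this edge.\<close>
  from packs_neighbour[OF this less.prems(4)] obtain p w where
    p: "{z, p} \<in> E" "b + unit_exp j = w + unit_exp p" "packs E s w"
    by (metis nat.inject)
  from p(2) show ?case
  proof (cases rule: add_unit_exp_eq_cases)
    case 1
    then show ?thesis
      using p(1) free_z by (intro exI[of _ "[z]"]) auto
  next
    case b': (2 b')
    \<comment> \<open>Otherwise the edge \<open>{z, p}\<close> would extend the packing to
      \<open>Suc s\<close> edges in \<open>b + unit_exp z\<close>. Hence the packing of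
      \<open>b\<close> uses \<open>p\<close>, with partner \<open>q\<close>.\<close>
    have "\<not> packs E s b'"
      using less.prems(3) packs_Suc[of E s b' z p] p(1) b'(1) by (auto simp: ac_simps)
    moreover have "packs E s (b' + unit_exp p)"
      using less.prems(1) b'(1) by simp
    ultimately obtain r q b1 where
      q: "s = Suc r" "{p, q} \<in> E" "b' = b1 + unit_exp q" "packs E r b1"
      using packs_neighbour by metis
    \<comment> \<open>Without \<open>p\<close> and \<open>q\<close> the same situation recurs with
      one edge less and \<open>q\<close> in the role of \<open>z\<close>; the walk gains the two
      vertices \<open>z\<close>, \<open>p\<close>.\<close>
    have "packs E (Suc r) (b1 + unit_exp q + unit_exp j)"
      using p(3) b'(2) q(1,3) by simp
    moreover have "\<not> packs E (Suc r) (b1 + unit_exp q)"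
      using \<open>\<not> packs E s b'\<close> q(1,3) by simp
    moreover have "\<not> packs E (Suc r) (b1 + unit_exp j)"
      using packs_Suc[of E s "b1 + unit_exp j" p q] q less.prems(4) b'(1)
      by (auto simp: ac_simps)
    ultimately obtain xs where xs: "xs \<noteq> []" "hd xs = q"
        "successively (\<lambda>x y. {x, y} \<in> E) (xs @ [j])" "odd (length xs)" "length xs \<le> 2 * r + 1"
        "\<forall>x\<in>set xs. ?free r b1 q x"
      using less.IH[of r b1 q] q(1,4) by blast
    have "?free s b z x" if x: "x \<in> set xs" for x
    proof -
      obtain w' where w': "packs E r w'"
        and "w' + unit_exp x = b1 + unit_exp q \<or> w' + unit_exp x = b1 + unit_exp j"
        using xs(6) x by blast
      \<comment> \<open>The missing edge is \<open>{z, p}\<close> in the first case and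
        \<open>{p, q}\<close> in the second.\<close>
      then consider "w' + unit_exp x = b1 + unit_exp q" | "w' + unit_exp x = b1 + unit_exp j"
        by blast
      then show ?thesis
      proof cases
        case 1
        have "(w' + unit_exp z + unit_exp p) + unit_exp x
            = (w' + unit_exp x) + (unit_exp z + unit_exp p)"
          by (simp add: ac_simps)
        also have "\<dots> = b + unit_exp z"
          unfolding 1 b'(1) q(3) by (simp add: ac_simps)
        finally show ?thesis
          using packs_Suc[OF w' p(1)] q(1) by blast
      next
        case 2
        have "(w' + unit_exp p + unit_exp q) + unit_exp x
            = (w' + unit_exp x) + (unit_exp p + unit_exp q)"
          by (simp add: ac_simps)
        also have "\<dots> = b + unit_exp j"
          unfolding 2 b'(1) q(3) by (simp add: ac_simps)
        finally show ?thesis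
          using packs_Suc[OF w' q(2)] q(1) by blast
      qed
    qed
    moreover have "?free s b z p"
      using p(2,3) by (metis (no_types))
    ultimately show ?thesis
      using p(1) q(1,2) xs free_z
      by (intro exI[of _ "z # p # xs"]) (auto simp: successively_Cons)
  qed
qed

section \<open>Odd closed walks\<close>

lemma closed_walk_imp_graph_cycle:
  assumes "c \<noteq> []" "successively (\<lambda>x y. {x, y} \<in> E) (c @ [hd c])" "distinct c" "length c \<ge> 3"
  shows "graph_cycle E c"
  unfolding graph_cycle_def
proof (intro conjI allI impI)
  fix i assume i: "i < length c"
  have "{(c @ [hd c]) ! i, (c @ [hd c]) ! Suc i} \<in> E"
    using assms(2) i by (auto simp: successively_conv_nth)
  then show "{c ! i, c ! (Suc i mod length c)} \<in> E"
    using i assms(1) by (cases "Suc i = length c") (auto simp: nth_append hd_conv_nth)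
qed (use assms in auto)

text \<open>A repeated vertex splits a closed walk into two shorter ones whose lengths add up to the
  old length, so one of them is odd.\<close>

lemma odd_closed_walk_contains_cycle:
  assumes "\<And>x. {x} \<notin> E"
    and "successively (\<lambda>x y. {x, y} \<in> E) (c @ [hd c])" "odd (length c)"
  shows "\<exists>c'. graph_cycle E c' \<and> set c' \<subseteq> set c \<and> odd (length c') \<and> length c' \<le> length c"
  using assms(2,3)
proof (induction "length c" arbitrary: c rule: less_induct)
  case less
  show ?case
  proof (cases "distinct c")
    case True
    have "c \<noteq> []"
      using less.prems(2) by auto
    \<comment> \<open>A closed walk of length 1 would be a loop.\<close>
    have "length c \<noteq> 1"
      using less.prems(1) assms(1) by (auto simp: length_Suc_conv)
    then have "length c \<ge> 3"
      using less.prems(2) by presburger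
    then show ?thesis
      using closed_walk_imp_graph_cycle[OF \<open>c \<noteq> []\<close> less.prems(1) True] less.prems(2) by blast
  next
    case False
    then obtain xs ys zs y where c: "c = xs @ [y] @ ys @ [y] @ zs"
      using not_distinct_decomp by blast
    have *: "successively (\<lambda>x y. {x, y} \<in> E) ((y # ys) @ [hd (y # ys)])"
      "successively (\<lambda>x y. {x, y} \<in> E) ((xs @ y # zs) @ [hd (xs @ y # zs)])"
      using less.prems(1) unfolding c
      by (auto simp: successively_append_iff successively_Cons hd_append split: if_splits)
    have "odd (length (y # ys)) \<or> odd (length (xs @ y # zs))"
      using less.prems(2) unfolding c by auto
    then obtain d where d: "successively (\<lambda>x y. {x, y} \<in> E) (d @ [hd d])" "odd (length d)"
        "length d < length c" "set d \<subseteq> set c"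
      using * that[of "y # ys"] that[of "xs @ y # zs"] unfolding c by auto
    then show ?thesis
      using less.hyps[OF d(3,1,2)] by (meson le_trans less_imp_le subset_trans)
  qed
qed

lemma successively_imp_rtrancl:
  "successively (\<lambda>x y. (x, y) \<in> r) (x # xs) \<Longrightarrow> y \<in> set (x # xs) \<Longrightarrow> (x, y) \<in> r\<^sup>*"
  by (induction xs arbitrary: x) (auto intro: converse_rtrancl_into_rtrancl)

section \<open>Monomial ideals\<close>

text \<open>The span of the monomials in the variables of \<open>V\<close> with exponent in
  \<open>S\<close>; an ideal once \<open>S\<close> is closed under adding exponents. Membership is
  tested monomial by monomial.\<close>

definition monomial_ideal :: "nat set \<Rightarrow> (nat \<Rightarrow>\<^sub>0 nat) set \<Rightarrow> 'k::field mpoly set" where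
  "monomial_ideal V S = {f \<in> carrier (poly_ring V). Poly_Mapping.keys f \<subseteq> S}"

lemma poly_ring_sel [simp]:
  "mult (poly_ring V) = (*)" "one (poly_ring V) = 1"
  "zero (poly_ring V) = 0" "add (poly_ring V) = (+)"
  by (simp_all add: poly_ring_def)

lemma carrier_poly_ring_iff:
  "f \<in> carrier (poly_ring V) \<longleftrightarrow> (\<forall>m\<in>Poly_Mapping.keys f. Poly_Mapping.keys m \<subseteq> V)"
  by (simp add: poly_ring_def)

lemma keys_add_nat: "Poly_Mapping.keys (v + w :: 'a \<Rightarrow>\<^sub>0 nat) = Poly_Mapping.keys v \<union> Poly_Mapping.keys w"
  by (auto simp: in_keys_iff lookup_add)

lemma single_in_carrier:
  "Poly_Mapping.keys m \<subseteq> V \<Longrightarrow> Poly_Mapping.single m c \<in> carrier (poly_ring V)"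
  by (auto simp: carrier_poly_ring_iff)

lemma pvar_in_carrier: "i \<in> V \<Longrightarrow> pvar i \<in> carrier (poly_ring V)"
  unfolding pvar_def by (rule single_in_carrier) simp

lemma mult_in_carrier:
  "f \<in> carrier (poly_ring V) \<Longrightarrow> g \<in> carrier (poly_ring V) \<Longrightarrow>
     f * g \<in> carrier (poly_ring V :: 'k::field mpoly ring)"
  using monoid.m_closed[OF comm_monoid.axioms(1)[OF cring.axioms(2)[OF poly_ring_cring]], of f V g]
  by simp

lemma ideal_monomial_ideal:
  assumes up: "\<And>m m'. m \<in> S \<Longrightarrow> m + m' \<in> S"
  shows "ideal (monomial_ideal V S :: 'k::field mpoly set) (poly_ring V)"
proof -
  interpret R: cring "poly_ring V :: 'k mpoly ring" by (rule poly_ring_cring)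
  have mult: "f * g \<in> monomial_ideal V S"
    if f: "f \<in> monomial_ideal V S" and g: "g \<in> carrier (poly_ring V)" for f g :: "'k mpoly"
  proof -
    have "f * g \<in> carrier (poly_ring V)"
      using mult_in_carrier[of f V g] f g by (simp add: monomial_ideal_def)
    then show ?thesis
      using keys_mult[of f g] f up by (fastforce simp: monomial_ideal_def)
  qed
  have "additive_subgroup (monomial_ideal V S :: 'k mpoly set) (poly_ring V)"
  proof (intro additive_subgroup.intro R.add.subgroupI)
    fix f g :: "'k mpoly"
    assume f: "f \<in> monomial_ideal V S" and g: "g \<in> monomial_ideal V S"
    show "f \<oplus>\<^bsub>poly_ring V\<^esub> g \<in> monomial_ideal V S"
      using f g R.a_closed[of f g] keys_add[of f g] by (auto simp: monomial_ideal_def)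
  next
    fix f :: "'k mpoly" assume f: "f \<in> monomial_ideal V S"
    have "- 1 \<in> carrier (poly_ring V :: 'k mpoly ring)"
      by (auto simp: carrier_poly_ring_iff)
    moreover have "\<ominus>\<^bsub>poly_ring V\<^esub> f = - f"
      using f by (intro R.minus_equality) (auto simp: monomial_ideal_def carrier_poly_ring_iff)
    ultimately show "\<ominus>\<^bsub>poly_ring V\<^esub> f \<in> monomial_ideal V S"
      using mult[OF f, of "- 1"] by simp
  next
    show "monomial_ideal V S \<noteq> ({} :: 'k mpoly set)"
      by (auto simp: monomial_ideal_def carrier_poly_ring_iff intro!: exI[of _ 0])
  qed (auto simp: monomial_ideal_def)
  then show ?thesis
    using mult
    by (intro idealI R.ring_axioms additive_subgroup.a_subgroup) (auto simp: mult.commute)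
qed

lemma poly_mapping_sum_singles:
  "f = (\<Sum>m\<in>Poly_Mapping.keys f. Poly_Mapping.single m (Poly_Mapping.lookup f m))"
  by (intro poly_mapping_eqI) (simp add: lookup_sum lookup_single when_def in_keys_iff sum.delta)

lemma monomial_ideal_subset:
  assumes K: "ideal K (poly_ring V :: 'k::field mpoly ring)"
    and gen: "\<And>m. m \<in> S \<Longrightarrow> Poly_Mapping.keys m \<subseteq> V \<Longrightarrow> Poly_Mapping.single m 1 \<in> K"
  shows "monomial_ideal V S \<subseteq> K"
proof
  interpret K: ideal K "poly_ring V" by (rule K)
  fix f :: "'k mpoly" assume f: "f \<in> monomial_ideal V S"
  have mem: "Poly_Mapping.single m (Poly_Mapping.lookup f m) \<in> K" if m: "m \<in> Poly_Mapping.keys f" for m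
  proof -
    \<comment> \<open>The coefficient is viewed as a constant polynomial, so that the term becomes a
      ring multiple of a monic monomial.\<close>
    have "Poly_Mapping.single 0 (Poly_Mapping.lookup f m) \<in> carrier (poly_ring V)"
      by (rule single_in_carrier) simp
    moreover have "Poly_Mapping.single m 1 \<in> K"
      using f m gen by (auto simp: monomial_ideal_def carrier_poly_ring_iff)
    ultimately show ?thesis
      using K.I_l_closed by (fastforce simp: mult_single)
  qed
  have "(\<Sum>m\<in>M. Poly_Mapping.single m (Poly_Mapping.lookup f m)) \<in> K"
    if "finite M" "M \<subseteq> Poly_Mapping.keys f" for M
    using that
  proof (induction rule: finite_induct)
    case empty
    then show ?case using additive_subgroup.zero_closed[OF K.is_additive_subgroup] by simp
  next
    case (insert m M)
    then show ?case using additive_subgroup.a_closed[OF K.is_additive_subgroup] mem by auto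
  qed
  from this[OF finite_keys order_refl] show "f \<in> K"
    by (simp only: poly_mapping_sum_singles[symmetric])
qed

section \<open>Powers of edge ideals\<close>

lemma pvar_mult_pvar: "pvar i * pvar j = Poly_Mapping.single (unit_exp i + unit_exp j) 1"
  by (simp add: pvar_def mult_single)

context
  fixes V :: "nat set" and E :: "nat set set"
  assumes edges: "\<And>e. e \<in> E \<Longrightarrow> e \<subseteq> V"
begin

lemma edge_gens_in_carrier:
  "{pvar i * pvar j | i j. {i, j} \<in> E} \<subseteq> carrier (poly_ring V :: 'k::field mpoly ring)"
proof clarify
  fix i j assume "{i, j} \<in> E"
  from edges[OF this] show "pvar i * pvar j \<in> carrier (poly_ring V :: 'k mpoly ring)"
    unfolding pvar_mult_pvar by (intro single_in_carrier) (simp add: keys_add_nat)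
qed

lemma ideal_edge_ideal: "ideal (edge_ideal V E :: 'k::field mpoly set) (poly_ring V)"
  unfolding edge_ideal_def
  by (intro ring.genideal_ideal cring.axioms(1)[OF poly_ring_cring] edge_gens_in_carrier)

lemma edge_in_edge_ideal:
  "{i, j} \<in> E \<Longrightarrow> Poly_Mapping.single (unit_exp i + unit_exp j) 1 \<in> (edge_ideal V E :: 'k::field mpoly set)"
  unfolding edge_ideal_def pvar_mult_pvar[symmetric]
  using ring.genideal_self[OF cring.axioms(1)[OF poly_ring_cring] edge_gens_in_carrier] by blast

lemma ideal_packs: "ideal (monomial_ideal V {m. packs E s m} :: 'k::field mpoly set) (poly_ring V)"
  by (rule ideal_monomial_ideal) (simp add: packs_mono)

lemma edge_ideal_subset: "edge_ideal V E \<subseteq> (monomial_ideal V {m. packs E 1 m} :: 'k::field mpoly set)"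
  unfolding edge_ideal_def
proof (intro ring.genideal_minimal cring.axioms(1)[OF poly_ring_cring] ideal_packs)
  show "{pvar i * pvar j | i j. {i, j} \<in> E} \<subseteq> (monomial_ideal V {m. packs E 1 m} :: 'k mpoly set)"
  proof clarify
    fix i j assume e: "{i, j} \<in> E"
    then have "pvar i * pvar j \<in> carrier (poly_ring V :: 'k mpoly ring)"
      using edge_gens_in_carrier by blast
    then show "pvar i * pvar j \<in> (monomial_ideal V {m. packs E 1 m} :: 'k mpoly set)"
      using packs_Suc[OF packs_0 e, of 0] by (simp add: monomial_ideal_def pvar_mult_pvar)
  qed
qed

text \<open>Supports of products consist of sums of exponents, and packings add; conversely,
  splitting one edge off a packing of \<open>Suc t\<close> edges factors the monomial.\<close>

lemma edge_ideal_power: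
  "ideal_power (poly_ring V :: 'k::field mpoly ring) (edge_ideal V E) t
     = monomial_ideal V {m. packs E t m}"
proof (induction t)
  case 0
  then show ?case
    by (auto simp: nat_pow_def ideals_set_def monomial_ideal_def packs_0)
next
  case (Suc t)
  let ?R = "poly_ring V :: 'k mpoly ring"
  let ?J = "\<lambda>t. monomial_ideal V {m. packs E t m} :: 'k mpoly set"
  have J: "additive_subgroup (?J (Suc t)) ?R"
    by (intro ideal.axioms(1) ideal_packs)
  have "ideal_power ?R (edge_ideal V E) (Suc t) = ideal_prod ?R (?J t) (edge_ideal V E)"
    using Suc by (simp add: nat_pow_def ideals_set_def)
  also have "\<dots> = ?J (Suc t)"
  proof
    show "ideal_prod ?R (?J t) (edge_ideal V E) \<subseteq> ?J (Suc t)"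
    proof
      fix f assume "f \<in> ideal_prod ?R (?J t) (edge_ideal V E)"
      then show "f \<in> ?J (Suc t)"
      proof induction
        case (prod f g)
        then have g: "g \<in> ?J 1" using edge_ideal_subset by blast
        have "f \<otimes>\<^bsub>?R\<^esub> g \<in> carrier ?R"
          using prod(1) g mult_in_carrier[of f V g] by (simp add: monomial_ideal_def)
        moreover have "packs E (Suc t) m" if "m \<in> Poly_Mapping.keys (f * g)" for m
        proof -
          obtain v w where "m = v + w" "v \<in> Poly_Mapping.keys f" "w \<in> Poly_Mapping.keys g"
            using keys_mult[of f g] \<open>m \<in> _\<close> by blast
          then show ?thesis
            using prod(1) g packs_add[of E t v 1 w] by (auto simp: monomial_ideal_def)
        qed
        ultimately show ?case
          by (auto simp: monomial_ideal_def)
      qed (rule additive_subgroup.a_closed[OF J])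
    qed
    have "ideal (ideal_prod ?R (?J t) (edge_ideal V E)) ?R"
      by (intro ring.ideal_prod_is_ideal cring.axioms(1)[OF poly_ring_cring] ideal_packs ideal_edge_ideal)
    then show "?J (Suc t) \<subseteq> ideal_prod ?R (?J t) (edge_ideal V E)"
    proof (rule monomial_ideal_subset)
      fix m assume "m \<in> {m. packs E (Suc t) m}" and m: "Poly_Mapping.keys m \<subseteq> V"
      then have "packs E (Suc t) m" by simp
      then obtain w u v where w: "m = w + unit_exp u + unit_exp v" "packs E t w" "{u, v} \<in> E"
        by (rule packs_SucE) auto
      have "Poly_Mapping.single w 1 \<in> ?J t"
        using w m single_in_carrier[of w V] by (auto simp: monomial_ideal_def keys_add_nat)
      from ideal_prod.prod[OF this edge_in_edge_ideal[OF w(3)], of ?R]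
      show "Poly_Mapping.single m 1 \<in> ideal_prod ?R (?J t) (edge_ideal V E)"
        by (simp add: mult_single w(1) ac_simps)
    qed
  qed
  finally show ?case .
qed

end

section \<open>Variable ideals and monomial witnesses of associated primes\<close>

lemma pvar_in_var_ideal:
  assumes "F \<subseteq> V" "i \<in> F"
  shows "pvar i \<in> (var_ideal V F :: 'k::field mpoly set)"
proof -
  have "pvar ` F \<subseteq> carrier (poly_ring V :: 'k mpoly ring)"
    using assms(1) pvar_in_carrier by blast
  then show ?thesis
    unfolding var_ideal_def
    using ring.genideal_self[OF cring.axioms(1)[OF poly_ring_cring]] assms(2) by blast
qed

lemma single_in_var_idealD:
  assumes "F \<subseteq> V" "Poly_Mapping.single m 1 \<in> (var_ideal V F :: 'k::field mpoly set)"
  shows "Poly_Mapping.keys m \<inter> F \<noteq> {}"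
proof -
  let ?S = "{m. Poly_Mapping.keys m \<inter> F \<noteq> {}}"
  have "var_ideal V F \<subseteq> (monomial_ideal V ?S :: 'k mpoly set)"
    unfolding var_ideal_def
  proof (intro ring.genideal_minimal cring.axioms(1)[OF poly_ring_cring] ideal_monomial_ideal)
    show "pvar ` F \<subseteq> (monomial_ideal V ?S :: 'k mpoly set)"
      using assms(1) by (auto simp: monomial_ideal_def pvar_def intro!: single_in_carrier)
  qed (auto simp: keys_add_nat)
  then show ?thesis
    using assms(2) by (auto simp: monomial_ideal_def)
qed

text \<open>Multiplying by a monomial shifts exponents injectively, so no terms cancel and the
  support is known exactly.\<close>

lemma keys_single_times:
  fixes f :: "'k::field mpoly"
  shows "Poly_Mapping.keys (Poly_Mapping.single g 1 * f) = (+) g ` Poly_Mapping.keys f"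
proof -
  have lookup: "Poly_Mapping.lookup (Poly_Mapping.single g 1 * f) (g + m) = Poly_Mapping.lookup f m" for m
  proof -
    have "Poly_Mapping.single g 1 * f
        = (\<Sum>m'\<in>Poly_Mapping.keys f. Poly_Mapping.single (g + m') (Poly_Mapping.lookup f m'))"
      by (subst poly_mapping_sum_singles[of f]) (simp add: sum_distrib_left mult_single)
    then show ?thesis
      by (simp add: lookup_sum lookup_single when_def in_keys_iff sum.delta)
  qed
  have "Poly_Mapping.keys (Poly_Mapping.single g 1 * f) \<subseteq> (+) g ` Poly_Mapping.keys f"
    using keys_mult[of "Poly_Mapping.single g 1" f] by auto
  moreover have "g + m \<in> Poly_Mapping.keys (Poly_Mapping.single g 1 * f)"
    if "m \<in> Poly_Mapping.keys f" for m
    using that lookup[of m] by (simp add: in_keys_iff)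
  ultimately show ?thesis by blast
qed

text \<open>
  If each of the finitely many monomials of the witness \<open>f\<close> entered the ideal after multiplication
  by some monomial supported off \<open>F\<close>, the product of these multipliers would lie in \<open>J : f = P\<^sub>F\<close>.
\<close>

lemma associated_prime_monomial:
  fixes V :: "nat set"
  assumes ass: "associated_prime (poly_ring V :: 'k::field mpoly ring) (monomial_ideal V S) (var_ideal V F)"
    and F: "F \<subseteq> V" and up: "\<And>m m'. m \<in> S \<Longrightarrow> m + m' \<in> S"
  obtains a where "\<And>i. i \<in> F \<Longrightarrow> a + unit_exp i \<in> S"
    and "\<And>g. Poly_Mapping.keys g \<subseteq> V - F \<Longrightarrow> a + g \<notin> S"
proof -
  obtain f :: "'k mpoly" where f: "f \<in> carrier (poly_ring V)"
    and P: "var_ideal V F = {g \<in> carrier (poly_ring V). g * f \<in> monomial_ideal V S}"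
    using ass by (auto simp: associated_prime_def)
  have 1: "a + unit_exp i \<in> S" if "i \<in> F" "a \<in> Poly_Mapping.keys f" for i a
  proof -
    have "pvar i * f \<in> monomial_ideal V S"
      using pvar_in_var_ideal[OF F that(1), where 'k='k] unfolding P by simp
    then show ?thesis
      using that(2) by (auto simp: monomial_ideal_def pvar_def keys_single_times add.commute)
  qed
  \<comment> \<open>Every monomial of \<open>f\<close> has the property for
    \<open>i \<in> F\<close>, so \<open>a\<close> is chosen for the other property alone.\<close>
  have "\<exists>a\<in>Poly_Mapping.keys f. \<forall>g. Poly_Mapping.keys g \<subseteq> V - F \<longrightarrow> a + g \<notin> S"
  proof (rule ccontr)
    assume "\<not> ?thesis"
    then obtain h where h: "\<And>a. a \<in> Poly_Mapping.keys f \<Longrightarrow> Poly_Mapping.keys (h a) \<subseteq> V - F \<and> a + h a \<in> S"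
      by metis
    define g where "g = sum h (Poly_Mapping.keys f)"
    have g: "Poly_Mapping.keys g \<subseteq> V - F"
      unfolding g_def using keys_sum[of h "Poly_Mapping.keys f"] h by blast
    have S: "g + a \<in> S" if "a \<in> Poly_Mapping.keys f" for a
    proof -
      have "g + a = (a + h a) + sum h (Poly_Mapping.keys f - {a})"
        unfolding g_def using sum.remove[OF finite_keys that, of h] by (simp add: ac_simps)
      then show ?thesis using up h[OF that] by simp
    qed
    have gc: "Poly_Mapping.single g (1::'k) \<in> carrier (poly_ring V)"
      using g by (intro single_in_carrier) blast
    have "Poly_Mapping.single g 1 * f \<in> monomial_ideal V S"
      using mult_in_carrier[OF gc f] S by (auto simp: monomial_ideal_def keys_single_times)
    then have "Poly_Mapping.single g 1 \<in> (var_ideal V F :: 'k mpoly set)"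
      unfolding P using gc by simp
    from single_in_var_idealD[OF F this] show False
      using g by blast
  qed
  then show thesis
    using 1 that by blast
qed

theorem theorem2p10:
  fixes n t :: nat and E :: "nat set set" and F :: "nat set"
  assumes "n \<ge> 1" and "t \<ge> 1"
    and "simple_graph {1..n} E"
    and "graph_cover {1..n} E F"
    and "embedded_associated_prime (poly_ring {1..n} :: 'k::field mpoly ring)
           (ideal_power (poly_ring {1..n}) (edge_ideal {1..n} E) t)
           (var_ideal {1..n} F)"
  shows "\<exists>U \<subseteq> {1..n}.
           (\<forall>C \<in> connected_comps U (induced_edges E U).
              \<exists>c. graph_cycle (induced_edges E U) c \<and> set c \<subseteq> C \<and>
                  odd (length c) \<and> length c \<le> 2 * t - 1) \<and>
           minimal_cover_containing {1..n} E (closed_nbhd E U) F"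
proof -
  define V where "V = {1..n}"
  obtain s where t: "t = Suc s" using assms(2) by (cases t) auto
  have edges: "e \<subseteq> V" "card e = 2" if "e \<in> E" for e
    using assms(3) that by (auto simp: simple_graph_def V_def)
  have F: "F \<subseteq> V" and cover: "\<And>e. e \<in> E \<Longrightarrow> F \<inter> e \<noteq> {}"
    using assms(4) by (auto simp: graph_cover_def V_def)
  have "associated_prime (poly_ring V :: 'k mpoly ring) (monomial_ideal V {m. packs E t m}) (var_ideal V F)"
    using assms(5) unfolding embedded_associated_prime_def V_def[symmetric]
    by (simp add: edge_ideal_power[OF edges(1)])
  then obtain a where a_F: "\<And>i. i \<in> F \<Longrightarrow> packs E t (a + unit_exp i)"
    and a_out: "\<And>g. Poly_Mapping.keys g \<subseteq> V - F \<Longrightarrow> \<not> packs E t (a + g)"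
    by (rule associated_prime_monomial) (use F packs_mono in auto)
  have a: "\<not> packs E t a"
    using a_out[of 0] by simp
  \<comment> \<open>\<open>D\<close> is not restricted to \<open>F\<close>, because the partner of a
    vertex of \<open>F\<close> may lie outside \<open>F\<close>.\<close>
  define D where "D = {j. \<exists>b. a = b + unit_exp j \<and> packs E s b}"
  define U where "U = D \<inter> F"
  have nbr_F: "y \<in> F" if x: "x \<in> D" and e: "{x, y} \<in> E" for x y
  proof (rule ccontr)
    assume "y \<notin> F"
    then have "\<not> packs E t (a + unit_exp y)"
      using edges(1)[OF e] by (intro a_out) auto
    then show False
      using x packs_Suc[OF _ e, of s] t by (auto simp: D_def)
  qed
  \<comment> \<open>The packing of \<open>a + unit_exp i\<close> must use the added
    \<open>i\<close>; its partner \<open>p\<close> is then freed from \<open>a\<close>.\<close>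
  have nbr_D: "\<exists>p\<in>D. {i, p} \<in> E" if "i \<in> F" for i
    using packs_neighbour[OF a_F[OF that] a] t by (auto simp: D_def) (metis nat.inject)
  have U_V: "U \<subseteq> V"
    using F by (auto simp: U_def)
  have N_F: "closed_nbhd E U \<subseteq> F"
    using nbr_F by (auto simp: closed_nbhd_def U_def)
  have min: "\<not> (graph_cover V E F' \<and> closed_nbhd E U \<subseteq> F')" if "F' \<subset> F" for F'
  proof
    assume F': "graph_cover V E F' \<and> closed_nbhd E U \<subseteq> F'"
    obtain i where i: "i \<in> F" "i \<notin> F'"
      using \<open>F' \<subset> F\<close> by blast
    obtain p where p: "p \<in> D" "{i, p} \<in> E"
      using nbr_D[OF i(1)] by blast
    \<comment> \<open>If \<open>p\<close> lies in \<open>F\<close>, then \<open>i\<close> is in the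
      closed neighbourhood of \<open>U\<close>; if not, \<open>F'\<close> misses the edge
      \<open>{i, p}\<close>. Both are impossible.\<close>
    have "p \<notin> F"
    proof
      assume "p \<in> F"
      then have "i \<in> closed_nbhd E U"
        using p by (auto simp: closed_nbhd_def U_def insert_commute)
      then show False using F' i(2) by blast
    qed
    then show False
      using F' i(2) p(2) \<open>F' \<subset> F\<close> by (auto simp: graph_cover_def)
  qed
  let ?E = "induced_edges E U"
  have cyc: "\<exists>c. graph_cycle ?E c \<and> set c \<subseteq> C \<and> odd (length c) \<and> length c \<le> 2 * t - 1"
    if C: "C \<in> connected_comps U ?E" for C
  proof -
    obtain j where j: "j \<in> U"
      and C_eq: "C = {(u, v) \<in> U \<times> U. (u, v) \<in> {(a, b). {a, b} \<in> ?E}\<^sup>*} `` {j}"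
      using C by (auto simp: connected_comps_def quotient_def)
    obtain b where b: "a = b + unit_exp j" "packs E s b"
      using j by (auto simp: U_def D_def)
    obtain xs where xs: "xs \<noteq> []" "hd xs = j" "successively (\<lambda>x y. {x, y} \<in> E) (xs @ [j])"
        "odd (length xs)" "length xs \<le> 2 * s + 1" "\<forall>x\<in>set xs. \<exists>w. packs E s w \<and> w + unit_exp x = a"
      \<comment> \<open>With \<open>z = j\<close> both alternatives for a freed vertex read
        \<open>w + unit_exp x = a\<close>, so all vertices of the walk lie in
        \<open>D\<close>.\<close>
      using alternating_walk[of E s b j j] b a a_F[of j] j t by (auto simp: U_def)
    have xs_D: "set xs \<subseteq> D"
      using xs(6) by (auto simp: D_def)
    \<comment> \<open>The walk starts in \<open>F\<close>, and neighbours of vertices of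
      \<open>D\<close> lie in \<open>F\<close>, so it never leaves \<open>F\<close>.\<close>
    have "set ys \<subseteq> F" if "hd ys \<in> F" "ys \<noteq> []" "set ys \<subseteq> D" "successively (\<lambda>x y. {x, y} \<in> E) ys" for ys
      using that
    proof (induction ys)
      case (Cons y ys)
      then show ?case
        using nbr_F[of y "hd ys"] by (cases "ys = []") (auto simp: successively_Cons)
    qed simp
    from this[of xs] have xs_U: "set xs \<subseteq> U"
      using xs xs_D j by (auto simp: U_def successively_append_iff)
    have walk: "successively (\<lambda>x y. {x, y} \<in> ?E) (xs @ [hd xs])"
      unfolding xs(2) using xs(3)
      by (rule successively_mono) (use xs_U j in \<open>auto simp: induced_edges_def\<close>)
    \<comment> \<open>A walk in the induced graph stays in the component of its start
      \<open>j\<close>, which is \<open>C\<close>.\<close>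
    have "successively (\<lambda>x y. (x, y) \<in> {(a, b). {a, b} \<in> ?E}) (j # tl xs)"
      using walk xs(1,2) by (auto simp: successively_append_iff)
    then have "set xs \<subseteq> C"
      using successively_imp_rtrancl[of "{(a, b). {a, b} \<in> ?E}" j "tl xs"] xs(1,2) xs_U j
      by (cases xs) (auto simp: C_eq)
    moreover have no_loop: "{x} \<notin> ?E" for x
      using edges(2)[of "{x}"] by (auto simp: induced_edges_def)
    moreover obtain c where "graph_cycle ?E c" "set c \<subseteq> set xs" "odd (length c)"
        "length c \<le> length xs"
      using odd_closed_walk_contains_cycle[OF no_loop walk xs(4)] by blast
    moreover have "length xs \<le> 2 * t - 1"
      using xs(5) t by simp
    ultimately show ?thesis
      by (intro exI[of _ c]) auto
  qed
  show ?thesis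
    using U_V cyc N_F min assms(4)
    by (intro exI[of _ U]) (auto simp: minimal_cover_containing_def V_def)
qed

end
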